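(* Let $a,b,c\in\mathbb{C}$. (1) If $a\neq1$ or $b\neq0$, all free non-trivial $TSV(a,b)$-modules of rank one over $\mathbb{C}[\partial]$ are as follows: $$M_{\alpha,\beta}=\mathbb{C}[\partial]v,\quad L_\lambda v=(\partial+\alpha\lambda+\beta)v,\quad Y_\lambda v=M_\lambda v=0,\quad\text{for some }\alpha,\beta\in\mathbb{C}.$$ In addition, all free non-trivial $TSV(1,0)$-modules of rank one over $\mathbb{C}[\partial]$ are as follows: $$M_{\alpha,\beta}=\mathbb{C}[\partial]v,\quad L_\lambda v=(\partial+\alpha\lambda+\beta)v,\quad Y_\lambda v=\gamma v,\quad M_\lambda v=0,\quad\text{for some }\alpha,\beta,\gamma\in\mathbb{C}.$$ (2) All free non-trivial $TSV(c)$-modules of rank one over $\mathbb{C}[\partial]$ are as follows: $$M_{\alpha,\beta}=\mathbb{C}[\partial]v,\quad L_\lambda v=(\partial+\alpha\lambda+\beta)v,\quad Y_\lambda v=M_\lambda v=0,\quad\text{for some }\alpha,\beta\in\mathbb{C}.$$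
   Context: A Lie conformal algebra $R$ is a $\mathbb{C}[\partial]$-module with a $\mathbb{C}$-bilinear $\lambda$-bracket $[\cdot_\lambda\cdot]:R\otimes R\to R[\lambda]$ such that for all $x,y,z\in R$: $[\partial x_\lambda y]=-\lambda[x_\lambda y]$, $[x_\lambda\partial y]=(\lambda+\partial)[x_\lambda y]$; $[x_\lambda y]=-[y_{-\lambda-\partial}x]$ (skew-symmetry); $[x_\lambda[y_\mu z]]=[[x_\lambda y]_{\lambda+\mu}z]+[y_\mu[x_\lambda z]]$ (Jacobi identity). For $a,b\in\mathbb{C}$, $TSV(a,b)=\mathbb{C}[\partial]L\oplus\mathbb{C}[\partial]M\oplus\mathbb{C}[\partial]Y$ is the Lie conformal algebra, free over $\mathbb{C}[\partial]$ with basis $L,M,Y$, with $\lambda$-brackets $$[L_\lambda L]=(\partial+2\lambda)L,\quad [L_\lambda Y]=(\partial+a\lambda+b)Y,\quad [L_\lambda M]=(\partial+2(a-1)\lambda+2b)M,$$ $$[Y_\lambda Y]=(\partial+2\lambda)M,\quad [Y_\lambda M]=[M_\lambda M]=0.$$ For $c\in\mathbb{C}$, $TSV(c)=\mathbb{C}[\partial]L\oplus\mathbb{C}[\partial]M\oplus\mathbb{C}[\partial]Y$ is the Lie conformal algebra, free over $\mathbb{C}[\partial]$ with basis $L,M,Y$, with $\lambda$-brackets $$[L_\lambda L]=(\partial+2\lambda)L,\quad [L_\lambda Y]=\left(\partial+\tfrac{3}{2}\lambda+c\right)Y,\quad [L_\lambda M]=(\partial+2c)M,$$ $$[Y_\lambda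 Y]=(\partial+2\lambda)(-\partial-2c)M,\quad [Y_\lambda M]=[M_\lambda M]=0.$$ In both cases the remaining brackets of basis elements are determined by skew-symmetry. A module (conformal module) $N$ over a Lie conformal algebra $R$ is a $\mathbb{C}[\partial]$-module with a $\mathbb{C}$-bilinear $\lambda$-action $R\otimes N\to N[\lambda]$, $x\otimes v\mapsto x_\lambda v$, such that $(\partial x)_\lambda v=-\lambda\,x_\lambda v$, $x_\lambda(\partial v)=(\lambda+\partial)x_\lambda v$ and $x_\lambda(y_\mu v)-y_\mu(x_\lambda v)=[x_\lambda y]_{\lambda+\mu}v$ for all $x,y\in R$, $v\in N$. "Free of rank one" means $N=\mathbb{C}[\partial]v$ is a free $\mathbb{C}[\partial]$-module on one generator $v$; "non-trivial" means that the $\lambda$-action of $R$ on $N$ is not identically zero. (The algebra generator $M$ is not to be confused with the module name $M_{\alpha,\beta}$.) *)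

theory Defs
  imports
    "HOL-Computational_Algebra.Polynomial"
    "HOL-Library.Product_Plus"
begin

text \<open>
  The ring \<open>\<complex>[\<partial>]\<close> is \<^typ>\<open>complex poly\<close>, with \<open>\<partial> = [:0, 1:]\<close>. For an additive group \<open>U\<close>, the
  group \<open>U[\<lambda>]\<close> is \<open>U poly\<close>: multiplication by \<open>\<lambda>\<close> is \<open>pCons 0\<close>, and an additive
  operator on \<open>U\<close> acts coefficientwise. The group \<open>U[\<lambda>, \<mu>]\<close> is \<open>U poly poly\<close>,
  where \<open>\<lambda>\<close> is the variable of the inner polynomials and \<open>\<mu>\<close> that of the outer ones.
\<close>

abbreviation del :: "complex poly" where
  "del \<equiv> [:0, 1:]"

definition mult_lambda :: "'u::ab_group_add poly poly \<Rightarrow> 'u poly poly" where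
  "mult_lambda = map_poly (pCons 0)"

definition mult_mu :: "'u::ab_group_add poly poly \<Rightarrow> 'u poly poly" where
  "mult_mu = pCons 0"

definition const2 :: "'u::ab_group_add \<Rightarrow> 'u poly poly" where
  "const2 u = [:[:u:]:]"

text \<open>
  Substitution of an operator \<open>T\<close> for the variable: the polynomial with coefficients
  \<open>u\<^sub>n\<close> is sent to the sum of the \<open>T\<^sup>n (e u\<^sub>n)\<close>, where \<open>e\<close> maps the coefficients to
  the group on which \<open>T\<close> operates.
\<close>

definition subst_op :: "('w \<Rightarrow> 'w) \<Rightarrow> ('u::zero \<Rightarrow> 'w::ab_group_add) \<Rightarrow> 'u poly \<Rightarrow> 'w" where
  "subst_op T e p = (\<Sum>n\<le>degree p. (T ^^ n) (e (coeff p n)))"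

text \<open>
  A \<open>\<complex>\<close>-bilinear map \<open>R \<otimes> N \<rightarrow> N[\<lambda>]\<close> that is sesquilinear over \<open>\<complex>[\<partial>]\<close>: the common part
  of the axioms for \<open>\<lambda>\<close>-brackets (\<open>N = R\<close>) and for \<open>\<lambda>\<close>-actions.
\<close>

locale lambda_map =
  R: module scaleR + N: module scaleN
  for scaleR :: "complex poly \<Rightarrow> 'r::ab_group_add \<Rightarrow> 'r"
    and scaleN :: "complex poly \<Rightarrow> 'n::ab_group_add \<Rightarrow> 'n" +
  fixes act :: "'r \<Rightarrow> 'n \<Rightarrow> 'n poly"
  assumes add_left: "act (x + y) v = act x v + act y v"
    and add_right: "act x (v + w) = act x v + act x w"
    and const_left: "act (scaleR [:k:] x) v = map_poly (scaleN [:k:]) (act x v)"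
    and const_right: "act x (scaleN [:k:] v) = map_poly (scaleN [:k:]) (act x v)"
    and del_left: "act (scaleR del x) v = - pCons 0 (act x v)"
    and del_right: "act x (scaleN del v) = pCons 0 (act x v) + map_poly (scaleN del) (act x v)"

text \<open>
  In \<open>skew\<close>, \<open>-\<lambda>-\<partial>\<close> is substituted as an operator on \<open>R[\<lambda>]\<close>. In \<open>jacobi\<close>, the three
  summands are the elements \<open>[x\<^sub>\<lambda>[y\<^sub>\<mu> z]]\<close>, \<open>[[x\<^sub>\<lambda> y]\<^bsub>\<lambda>+\<mu>\<^esub> z]\<close> and \<open>[y\<^sub>\<mu>[x\<^sub>\<lambda> z]]\<close> of
  \<open>R[\<lambda>, \<mu>]\<close>.
\<close>

locale lie_conformal_algebra = lambda_map scale scale bracket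
  for scale :: "complex poly \<Rightarrow> 'r::ab_group_add \<Rightarrow> 'r"
    and bracket :: "'r \<Rightarrow> 'r \<Rightarrow> 'r poly" +
  assumes skew:
    "bracket x y =
      - subst_op (\<lambda>q. - pCons 0 q - map_poly (scale del) q) (\<lambda>r. [:r:]) (bracket y x)"
    and jacobi:
    "subst_op mult_mu (\<lambda>w. subst_op mult_lambda const2 (bracket x w)) (bracket y z) =
      subst_op mult_lambda
        (\<lambda>w. subst_op (\<lambda>q. mult_lambda q + mult_mu q) const2 (bracket w z)) (bracket x y) +
      subst_op mult_lambda (\<lambda>w. subst_op mult_mu const2 (bracket y w)) (bracket x z)"

locale conformal_module =
  lie_conformal_algebra scaleR bracket + action: lambda_map scaleR scaleN act
  for scaleR :: "complex poly \<Rightarrow> 'r::ab_group_add \<Rightarrow> 'r"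
    and bracket :: "'r \<Rightarrow> 'r \<Rightarrow> 'r poly"
    and scaleN :: "complex poly \<Rightarrow> 'n::ab_group_add \<Rightarrow> 'n"
    and act :: "'r \<Rightarrow> 'n \<Rightarrow> 'n poly" +
  assumes act_bracket:
    "subst_op mult_mu (\<lambda>w. subst_op mult_lambda const2 (act x w)) (act y v) -
      subst_op mult_lambda (\<lambda>w. subst_op mult_mu const2 (act y w)) (act x v) =
      subst_op mult_lambda
        (\<lambda>w. subst_op (\<lambda>q. mult_lambda q + mult_mu q) const2 (act w v)) (bracket x y)"

definition nontrivial_action :: "('r \<Rightarrow> 'n \<Rightarrow> 'n::zero poly) \<Rightarrow> bool" where
  "nontrivial_action act \<longleftrightarrow> (\<exists>x v. act x v \<noteq> 0)"

definition free_rank_one :: "(complex poly \<Rightarrow> 'n::ab_group_add \<Rightarrow> 'n) \<Rightarrow> 'n \<Rightarrow> bool" where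
  "free_rank_one scale v \<longleftrightarrow>
    module scale \<and> \<not> module.dependent scale {v} \<and> module.span scale {v} = UNIV"

locale free_LMY = lie_conformal_algebra scale bracket
  for scale :: "complex poly \<Rightarrow> 'r::ab_group_add \<Rightarrow> 'r"
    and bracket :: "'r \<Rightarrow> 'r \<Rightarrow> 'r poly" +
  fixes L M Y :: 'r
  assumes distinct: "distinct [L, M, Y]"
    and independent: "R.independent {L, M, Y}"
    and span: "R.span {L, M, Y} = UNIV"

text \<open>The polynomial \<open>[: u, w :]\<close> is \<open>u + \<lambda> w\<close>, e.g. \<open>[L\<^sub>\<lambda> L] = \<partial> L + \<lambda> (2 L)\<close>.\<close>

locale TSV_ab = free_LMY scale bracket L M Y
  for a b :: complex
    and scale :: "complex poly \<Rightarrow> 'r::ab_group_add \<Rightarrow> 'r"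
    and bracket :: "'r \<Rightarrow> 'r \<Rightarrow> 'r poly"
    and L M Y :: 'r +
  assumes LL: "bracket L L = [: scale del L, scale [:2:] L :]"
    and LY: "bracket L Y = [: scale (del + [:b:]) Y, scale [:a:] Y :]"
    and LM: "bracket L M = [: scale (del + [:2 * b:]) M, scale [:2 * (a - 1):] M :]"
    and YY: "bracket Y Y = [: scale del M, scale [:2:] M :]"
    and YM: "bracket Y M = 0"
    and MM: "bracket M M = 0"

locale TSV_c = free_LMY scale bracket L M Y
  for c :: complex
    and scale :: "complex poly \<Rightarrow> 'r::ab_group_add \<Rightarrow> 'r"
    and bracket :: "'r \<Rightarrow> 'r \<Rightarrow> 'r poly"
    and L M Y :: 'r +
  assumes LL: "bracket L L = [: scale del L, scale [:2:] L :]"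
    and LY: "bracket L Y = [: scale (del + [:c:]) Y, scale [:3 / 2:] Y :]"
    and LM: "bracket L M = [: scale (del + [:2 * c:]) M :]"
    and YY: "bracket Y Y =
      [: scale (del * (- del - [:2 * c:])) M, scale ([:2:] * (- del - [:2 * c:])) M :]"
    and YM: "bracket Y M = 0"
    and MM: "bracket M M = 0"

end

theory Submission
  imports Defs "HOL-Computational_Algebra.Fundamental_Theorem_Algebra"
begin

text \<open>
  On a free module \<open>\<complex>[\<partial>]v\<close> an action is given by polynomials \<open>X(\<lambda>, \<partial>)\<close> with
  \<open>x\<^sub>\<lambda> v = X(\<lambda>, \<partial>) v\<close>, and the module axiom becomes
  \<open>Y(\<mu>, \<partial> + \<lambda>) X(\<lambda>, \<partial>) - X(\<lambda>, \<partial> + \<mu>) Y(\<mu>, \<partial>) = [x\<^sub>\<lambda> y](\<lambda> + \<mu>, \<partial>)\<close>; by sesquilinearity and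
  skew-symmetry it is enough to test it on pairs of basis elements. If \<open>X\<close> has degree \<open>n\<close> in \<open>\<partial>\<close>
  with leading coefficient \<open>g(\<lambda>)\<close>, the coefficient of \<open>\<partial>\<^bsup>2n-1\<^esup>\<close> in the commutator of \<open>X\<close> with itself
  is \<open>n (\<lambda> - \<mu>) g(\<lambda>) g(\<mu>)\<close>. Hence \<open>n \<le> 1\<close> for \<open>L\<close>, which gives \<open>\<partial> + \<alpha>\<lambda> + \<beta>\<close>, and \<open>n = 0\<close> for
  an element with \<open>[x\<^sub>\<lambda> x] = 0\<close> on the module. Commutation with \<open>L\<close> then makes the polynomial of
  \<open>M\<close> a constant, which vanishes because \<open>[Y\<^sub>\<lambda> M] = 0\<close> makes \<open>Y\<close> commute with itself, whereas
  \<open>[Y\<^sub>\<lambda> Y]\<close> is a nonzero multiple of \<open>M\<close>. Finally \<open>Y\<close> commutes with itself, so it acts by a constant,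
  and commutation with \<open>L\<close> makes this zero unless \<open>[L\<^sub>\<lambda> Y] = (\<partial> + \<lambda>) Y\<close>.
\<close>

subsection \<open>Polynomial identities\<close>

text \<open>Taylor expansion: the second and higher derivatives of \<open>p\<close> have degree
  below \<open>n\<close>, so only \<open>p\<close> and \<open>s\<close> times its derivative
  contribute.\<close>

lemma coeff_pcompose_shift_top:
  fixes p :: "complex poly"
  shows "degree p \<le> Suc n \<Longrightarrow>
    coeff (p \<circ>\<^sub>p [:s, 1:]) n = coeff p n + s * of_nat (Suc n) * coeff p (Suc n)"
proof (induction p arbitrary: n)
  case 0
  then show ?case by simp
next
  case (pCons a p)
  show ?case
  proof (cases n)
    case 0
    with pCons.prems have "degree p = 0"
      by (cases "p = 0") auto
    then obtain c where "p = [:c:]"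
      by (rule degree_eq_zeroE)
    with 0 show ?thesis
      by (simp add: pcompose_pCons)
  next
    case (Suc k)
    with pCons.prems have d: "degree p \<le> Suc k"
      by (cases "p = 0") auto
    then have "coeff p (Suc (Suc k)) = 0"
      by (simp add: coeff_eq_0)
    with pCons.IH[of k] pCons.IH[of "Suc k"] d Suc show ?thesis
      by (simp add: pcompose_pCons algebra_simps)
  qed
qed

text \<open>If neither \<open>i\<close> nor \<open>2 * m + 1 - i\<close> exceeds
  \<open>Suc m\<close>, then \<open>i\<close> is \<open>m\<close> or \<open>Suc m\<close>.\<close>

lemma coeff_mult_subtop:
  fixes p q :: "complex poly"
  assumes "degree p \<le> Suc m" "degree q \<le> Suc m"
  shows "coeff (p * q) (2 * m + 1) =
    coeff p m * coeff q (Suc m) + coeff p (Suc m) * coeff q m"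
proof -
  have "coeff (p * q) (2 * m + 1) = (\<Sum>i\<le>2 * m + 1. coeff p i * coeff q (2 * m + 1 - i))"
    by (rule coeff_mult)
  also have "\<dots> = (\<Sum>i\<in>{m, Suc m}. coeff p i * coeff q (2 * m + 1 - i))"
  proof (rule sum.mono_neutral_right)
    show "\<forall>i\<in>{..2 * m + 1} - {m, Suc m}. coeff p i * coeff q (2 * m + 1 - i) = 0"
    proof
      fix i assume i: "i \<in> {..2 * m + 1} - {m, Suc m}"
      then consider "i > Suc m" | "2 * m + 1 - i > Suc m" by force
      then show "coeff p i * coeff q (2 * m + 1 - i) = 0"
        using assms by cases (auto simp: coeff_eq_0)
    qed
  qed auto
  also have "\<dots> = coeff p m * coeff q (Suc m) + coeff p (Suc m) * coeff q m"
    by (simp add: numeral_2_eq_2)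
  finally show ?thesis .
qed

text \<open>The mixed products of top and subtop coefficients cancel; what remains are the
  first-order Taylor terms of the two shifts.\<close>

lemma coeff_shift_commutator:
  fixes p q :: "complex poly"
  assumes "degree p \<le> Suc m" "degree q \<le> Suc m"
  shows "coeff ((p \<circ>\<^sub>p [:s, 1:]) * q - (q \<circ>\<^sub>p [:t, 1:]) * p) (2 * m + 1) =
    of_nat (Suc m) * (s - t) * (coeff p (Suc m) * coeff q (Suc m))"
proof -
  have "degree (p \<circ>\<^sub>p [:s, 1:]) \<le> Suc m" "degree (q \<circ>\<^sub>p [:t, 1:]) \<le> Suc m"
    using assms degree_pcompose[of p "[:s, 1:]"] degree_pcompose[of q "[:t, 1:]"] by auto
  \<comment> \<open>With these zeros the shift formula at \<open>n = Suc m\<close> shows that the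
    top coefficients are unchanged by the shifts.\<close>
  moreover have "coeff p (Suc (Suc m)) = 0" "coeff q (Suc (Suc m)) = 0"
    using assms by (auto simp: coeff_eq_0)
  ultimately show ?thesis
    using assms by (simp only: coeff_diff coeff_mult_subtop coeff_pcompose_shift_top le_SucI)
      (simp add: algebra_simps)
qed

text \<open>
  Contrary to the encoding of actions, \<open>\<partial> = z\<close> is here the outer variable of \<open>Q\<close> and \<open>\<lambda> = s\<close> the
  inner one, so that degrees and coefficients of \<open>Q\<close> are those in \<open>\<partial>\<close>.
\<close>

definition section_poly :: "complex poly poly \<Rightarrow> complex \<Rightarrow> complex poly" where
  "section_poly Q s = map_poly (\<lambda>p. poly p s) Q"

lemma coeff_section_poly [simp]: "coeff (section_poly Q s) n = poly (coeff Q n) s"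
  by (simp add: section_poly_def coeff_map_poly)

lemma degree_section_poly_le: "degree (section_poly Q s) \<le> degree Q"
  by (rule degree_le) (simp add: coeff_eq_0)

text \<open>The extra factor vanishing at \<open>r\<close> forces a non-root of the product to
  differ from \<open>r\<close>.\<close>

lemma poly_nonzero_point: "\<exists>s. poly g s \<noteq> 0 \<and> s \<noteq> r" if "g \<noteq> 0" for g :: "complex poly"
proof -
  have "[:- r, 1:] * g \<noteq> 0"
    using that unfolding mult_eq_0_iff by simp
  then obtain s where "poly ([:- r, 1:] * g) s \<noteq> 0"
    using poly_all_0_iff_0 by blast
  then show ?thesis by auto
qed

lemma lead_coeff_distinct_points:
  fixes Q :: "complex poly poly"
  assumes "Q \<noteq> 0"
  obtains s t where "s \<noteq> t" "poly (lead_coeff Q) s \<noteq> 0" "poly (lead_coeff Q) t \<noteq> 0"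
  using poly_nonzero_point[of "lead_coeff Q"] assms by (metis leading_coeff_0_iff)

lemma degree_0_if_commuting:
  assumes F: "\<And>s z. F s z = poly (section_poly Q s) z"
    and comm: "\<And>s t z. F t (z + s) * F s z - F s (z + t) * F t z = 0"
  shows "degree Q = 0"
proof (rule ccontr)
  assume "degree Q \<noteq> 0"
  then obtain m where m: "degree Q = Suc m" by (cases "degree Q") auto
  then have "Q \<noteq> 0" by auto
  then obtain s t where st: "s \<noteq> t" "poly (lead_coeff Q) s \<noteq> 0" "poly (lead_coeff Q) t \<noteq> 0"
    using lead_coeff_distinct_points by metis
  let ?C = "(section_poly Q t \<circ>\<^sub>p [:s, 1:]) * section_poly Q s -
    (section_poly Q s \<circ>\<^sub>p [:t, 1:]) * section_poly Q t"
  have "poly ?C z = 0" for z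
    using comm[of t z s] by (simp add: F poly_pcompose add.commute)
  then have "?C = 0"
    using poly_all_0_iff_0 by blast
  then have "coeff ?C (2 * m + 1) = 0" by (simp only: coeff_0)
  then show False
    using coeff_shift_commutator[of "section_poly Q t" m "section_poly Q s" s t]
      degree_section_poly_le[of Q] m st by (simp del: of_nat_Suc)
qed

text \<open>Since \<open>g\<close> takes the value 1 at 0, the product of its values at
  \<open>z\<close> and \<open>- z\<close> is 1. So \<open>g\<close> has no roots and is constant by
  the fundamental theorem of algebra.\<close>

lemma poly_const_if_multiplicative:
  fixes g :: "complex poly"
  assumes mult: "\<And>s t. s \<noteq> t \<Longrightarrow> poly g s * poly g t = poly g (s + t)" and "g \<noteq> 0"
  shows "g = 1"
proof -
  obtain s where "poly g s \<noteq> 0" "s \<noteq> 0"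
    using poly_nonzero_point[OF \<open>g \<noteq> 0\<close>] by blast
  with mult[of s 0] have g0: "poly g 0 = 1" by simp
  have "poly g z \<noteq> 0" for z
    using mult[of z "- z"] g0 by (cases "z = 0") auto
  then have "constant (poly g)"
    using fundamental_theorem_of_algebra by blast
  then have "degree g = 0"
    by (simp add: constant_degree)
  then obtain c where "g = [:c:]"
    by (rule degree_eq_zeroE)
  with g0 show ?thesis by (simp add: one_pCons)
qed

text \<open>The assumption multiplies the coefficient of degree \<open>k\<close> by
  \<open>1 - 2 * 2 ^ k + 3 ^ k\<close>, which is nonzero for all \<open>k \<ge> 2\<close>.\<close>

lemma linear_if_second_difference:
  fixes g :: "complex poly"
  assumes "\<And>s. s \<noteq> 0 \<Longrightarrow> poly g s - 2 * poly g (2 * s) + poly g (3 * s) = 0"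
  shows "\<exists>\<alpha> \<beta>. g = [:\<beta>, \<alpha>:]"
proof -
  let ?h = "g - smult 2 (g \<circ>\<^sub>p [:0, 2:]) + g \<circ>\<^sub>p [:0, 3:]"
  have "?h = 0"
    using assms poly_nonzero_point[of ?h 0] by (force simp: poly_pcompose mult.commute)
  have "coeff g k = 0" if "k \<ge> 2" for k
  proof -
    define j where "j = k - 2"
    then have k: "k = j + 2" using that by simp
    have "(2::nat) ^ Suc k < 3 ^ k + 1"
    proof -
      have "(2::nat) ^ j \<le> 3 ^ j" by (simp add: power_mono)
      then show ?thesis by (simp add: k)
    qed
    then have "of_nat (2 ^ Suc k) \<noteq> (of_nat (3 ^ k + 1) :: complex)"
      by (simp only: of_nat_eq_iff)
    then have "1 - 2 * 2 ^ k + 3 ^ k \<noteq> (0::complex)"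
      by (auto simp: algebra_simps)
    moreover have "coeff ?h k = (1 - 2 * 2 ^ k + 3 ^ k) * coeff g k"
      by (simp add: coeff_pcompose_linear algebra_simps)
    ultimately show ?thesis
      using \<open>?h = 0\<close> by simp
  qed
  then have "g = [:coeff g 0, coeff g 1:]"
    by (intro poly_eqI) (auto simp: coeff_pCons split: nat.splits)
  then show ?thesis by (intro exI)
qed

lemma virasoro_rank_one:
  assumes F: "\<And>s z. F s z = poly (section_poly Q s) z"
    and vir: "\<And>s t z. F t (z + s) * F s z - F s (z + t) * F t z = (s - t) * F (s + t) z"
  shows "(\<forall>s z. F s z = 0) \<or> (\<exists>\<alpha> \<beta>. \<forall>s z. F s z = z + \<alpha> * s + \<beta>)"
proof (cases "degree Q")
  \<comment> \<open>A symbol independent of \<partial> commutes with itself, so the right-hand side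
    must vanish.\<close>
  case 0
  then obtain g where "Q = [:g:]"
    by (rule degree_eq_zeroE)
  then have Fg: "F s z = poly g s" for s z
    by (simp add: F section_poly_def map_poly_pCons)
  have "g = 0"
  proof (rule ccontr)
    assume "g \<noteq> 0"
    then obtain s where "poly g s \<noteq> 0" "s \<noteq> 0"
      using poly_nonzero_point by blast
    then show False using vir[of 0 0 s] by (simp add: Fg)
  qed
  then show ?thesis by (simp add: Fg)
next
  case (Suc m)
  let ?C = "\<lambda>s t. (section_poly Q t \<circ>\<^sub>p [:s, 1:]) * section_poly Q s -
    (section_poly Q s \<circ>\<^sub>p [:t, 1:]) * section_poly Q t"
  have "poly (?C s t) z = poly (smult (s - t) (section_poly Q (s + t))) z" for s t z
    using vir[of t z s] by (simp add: F poly_pcompose add.commute)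
  then have C: "?C s t = smult (s - t) (section_poly Q (s + t))" for s t
    using poly_eq_poly_eq_iff by blast
  \<comment> \<open>Comparison of the coefficients of \<open>z ^ (2 * m + 1)\<close>. For
    \<open>m > 0\<close> this exponent exceeds the degree of the right-hand side; for
    \<open>m = 0\<close> the leading coefficient becomes multiplicative.\<close>
  have top: "of_nat (Suc m) * (s - t) * (poly (lead_coeff Q) t * poly (lead_coeff Q) s) =
      (s - t) * poly (coeff Q (2 * m + 1)) (s + t)" for s t
    using coeff_shift_commutator[of "section_poly Q t" m "section_poly Q s" s t, unfolded C]
      degree_section_poly_le[of Q] unfolding Suc by (simp only: coeff_smult coeff_section_poly)
  have "Q \<noteq> 0" using Suc by auto
  have "m = 0"
  proof (rule ccontr)
    assume "m \<noteq> 0"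
    then have "coeff Q (2 * m + 1) = 0" using Suc by (simp add: coeff_eq_0)
    moreover obtain s t where "s \<noteq> t" "poly (lead_coeff Q) s \<noteq> 0" "poly (lead_coeff Q) t \<noteq> 0"
      using lead_coeff_distinct_points[OF \<open>Q \<noteq> 0\<close>] by metis
    ultimately show False using top[of s t] by (simp del: of_nat_Suc)
  qed
  define g where "g = coeff Q 0"
  have "coeff Q 1 = 1"
  proof (rule poly_const_if_multiplicative)
    show "coeff Q 1 \<noteq> 0" using \<open>Q \<noteq> 0\<close> Suc \<open>m = 0\<close> by (metis One_nat_def leading_coeff_0_iff)
    show "poly (coeff Q 1) s * poly (coeff Q 1) t = poly (coeff Q 1) (s + t)"
      if "s \<noteq> t" for s t
      using top[of s t] that Suc \<open>m = 0\<close> by (simp add: mult.commute)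
  qed
  moreover have "Q = [:coeff Q 0, coeff Q 1:]"
    using Suc \<open>m = 0\<close> by (intro poly_eqI) (auto simp: coeff_pCons coeff_eq_0 split: nat.splits)
  ultimately have "Q = [:g, 1:]" by (simp add: g_def)
  then have Fg: "F s z = z + poly g s" for s z
    by (simp add: F section_poly_def map_poly_pCons)
  have "\<exists>\<alpha> \<beta>. g = [:\<beta>, \<alpha>:]"
  proof (rule linear_if_second_difference)
    fix s :: complex assume "s \<noteq> 0"
    \<comment> \<open>At \<open>t = 2 * s\<close>, \<open>z = 0\<close> the products of values of
      \<open>g\<close> cancel and only linear terms survive.\<close>
    moreover have "s * (poly g s - 2 * poly g (2 * s) + poly g (3 * s)) = 0"
      using vir[of "2 * s" 0 s] by (simp add: Fg algebra_simps)
    ultimately show "poly g s - 2 * poly g (2 * s) + poly g (3 * s) = 0" by simp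
  qed
  then show ?thesis using Fg by (force simp: algebra_simps)
qed

text \<open>The assumption is the commutation with \<partial> + \<alpha>\<lambda> + \<beta> of a
  symbol \<open>g\<close> independent of \<partial>. At \<open>t = 0\<close> it says that
  \<open>k * s + e\<close> annihilates \<open>g\<close>; if \<open>k = e = 0\<close>, it says that
  \<open>g\<close> is invariant under translation.\<close>

lemma primary_current_constant:
  fixes g :: "complex poly"
  assumes eq: "\<And>s t. - t * poly g t = (k * s - t + e) * poly g (s + t)"
  shows "g = 0 \<or> (k = 0 \<and> e = 0 \<and> (\<exists>c. g = [:c:]))"
proof (cases "k = 0 \<and> e = 0")
  case True
  have "poly g s = poly g 0" for s
    using eq[of 1 "s - 1"] eq[of 1 "- 1"] True by simp
  then have "g = [:poly g 0:]"
    by (intro poly_ext) simp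
  then show ?thesis using True by blast
next
  case False
  have "[:e, k:] * g = 0"
  proof (rule poly_ext)
    show "poly ([:e, k:] * g) s = poly 0 s" for s
      using eq[of 0 s] by (simp add: algebra_simps)
  qed
  then have "g = 0"
    using False by (simp only: mult_eq_0_iff pCons_eq_0_iff) blast
  then show ?thesis ..
qed

subsection \<open>Evaluation of polynomials with module coefficients\<close>

text \<open>The value at \<lambda> = \<open>s\<close> after a functional has been applied to the
  coefficients. Iterated, it evaluates polynomials in \<lambda> and \<mu>.\<close>

definition peval :: "('u::zero \<Rightarrow> complex) \<Rightarrow> complex \<Rightarrow> 'u poly \<Rightarrow> complex" where
  "peval e s p = poly (map_poly e p) s"

lemma peval_0 [simp]: "peval e s 0 = 0"
  by (simp add: peval_def)

lemma peval_pCons [simp]: "e 0 = 0 \<Longrightarrow> peval e s (pCons u p) = e u + s * peval e s p"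
  by (simp add: peval_def map_poly_pCons)

lemma additive_peval: "additive e \<Longrightarrow> additive (peval e s)"
proof
  assume e: "additive e"
  have "map_poly e (p + q) = map_poly e p + map_poly e q" for p q
    by (intro poly_eqI) (simp add: coeff_map_poly additive.zero[OF e] additive.add[OF e])
  then show "peval e s (p + q) = peval e s p + peval e s q" for p q
    by (simp add: peval_def)
qed

lemma peval_map_poly:
  assumes "e 0 = 0" "g 0 = 0" "\<And>u. e (g u) = c * e u"
  shows "peval e s (map_poly g p) = c * peval e s p"
  using assms by (induction p) (simp_all add: map_poly_pCons algebra_simps)

lemma peval_cmult:
  assumes "e 0 = 0"
  shows "peval (\<lambda>u. c * e u) s p = c * peval e s p"
  using assms by (induction p) (simp_all add: algebra_simps)

text \<open>Each functional turns \<open>W\<close> into a complex polynomial without nonzero values,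
  hence the zero polynomial; so all functionals vanish on every coefficient.\<close>

lemma peval_separating:
  assumes zero: "\<And>z. e z 0 = 0"
    and sep: "\<And>u. (\<And>z. e z u = 0) \<Longrightarrow> u = 0"
    and W: "\<And>s z. peval (e z) s W = 0"
  shows "W = 0"
proof (rule poly_eqI)
  fix n
  have "map_poly (e z) W = 0" for z
    using W[of z] poly_all_0_iff_0 unfolding peval_def by blast
  then have "e z (coeff W n) = 0" for z
    using zero[of z] by (metis coeff_0 coeff_map_poly)
  then show "coeff W n = coeff 0 n"
    using sep by simp
qed

text \<open>Under \<open>E\<close> the operator \<open>T\<close> becomes the number
  \<open>\<tau>\<close>, so substituting the operator becomes evaluating at that number.\<close>

lemma eval_subst_op:
  assumes E: "additive E" and e: "e 0 = 0" and T: "\<And>q. E (T q) = \<tau> * E q"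
  shows "E (subst_op T e p) = peval (\<lambda>u. E (e u)) \<tau> p"
proof -
  interpret additive E by fact
  have pow: "E ((T ^^ n) q) = \<tau> ^ n * E q" for n q
    by (induction n) (simp_all add: T)
  have 0: "E (e 0) = 0" by (simp add: e zero)
  have "peval (\<lambda>u. E (e u)) \<tau> p = (\<Sum>n\<le>degree p. coeff (map_poly (\<lambda>u. E (e u)) p) n * \<tau> ^ n)"
    unfolding peval_def poly_altdef
  \<comment> \<open>Applying the functional to the coefficients can lower the degree; the additional
    terms are zero.\<close>
  proof (rule sum.mono_neutral_left)
    show "{..degree (map_poly (\<lambda>u. E (e u)) p)} \<subseteq> {..degree p}"
      using degree_le[of "degree p" "map_poly (\<lambda>u. E (e u)) p"]
      by (simp add: coeff_map_poly 0 coeff_eq_0)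
  qed (auto simp: coeff_eq_0)
  also have "\<dots> = E (subst_op T e p)"
    by (simp add: subst_op_def sum pow coeff_map_poly[of "\<lambda>u. E (e u)", OF 0] mult.commute)
  finally show ?thesis ..
qed

text \<open>A \<complex>[\<partial>]-linear map to the one-dimensional module on which \<partial>
  acts as \<open>c\<close>.\<close>

definition evaluation ::
    "(complex poly \<Rightarrow> 'u::ab_group_add \<Rightarrow> 'u) \<Rightarrow> ('u \<Rightarrow> complex) \<Rightarrow> complex \<Rightarrow> bool" where
  "evaluation scale E c \<longleftrightarrow> additive E \<and> (\<forall>p u. E (scale p u) = poly p c * E u)"

lemma evaluationD:
  assumes "evaluation scale E c"
  shows "additive E" "E (scale p u) = poly p c * E u" "E 0 = 0"
  using assms additive.zero unfolding evaluation_def by blast+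

section \<open>Sesquilinear maps under evaluation\<close>

context lambda_map
begin

lemma act_0_left [simp]: "act 0 w = 0"
  using add_left[of 0 0 w] by simp

lemma act_0_right [simp]: "act x 0 = 0"
  using add_right[of x 0 0] by simp

lemma pCons_conv_del: "pCons a p = [:a:] + del * p"
  by simp

lemma scale_pConsN: "scaleN (pCons a p) w = scaleN [:a:] w + scaleN del (scaleN p w)"
  by (subst pCons_conv_del) (simp only: N.scale_left_distrib N.scale_scale)

lemma scale_pConsR: "scaleR (pCons a p) w = scaleR [:a:] w + scaleR del (scaleR p w)"
  by (subst pCons_conv_del) (simp only: R.scale_left_distrib R.scale_scale)

context
  fixes E c
  assumes E: "evaluation scaleN E c"
begin

lemma additive_peval_act:
  "additive (\<lambda>x. peval E s (act x w))" "additive (\<lambda>w. peval E s (act x w))"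
  by (standard; simp add: add_left add_right additive.add[OF additive_peval] evaluationD[OF E])+

lemma peval_map_scale: "peval E s (map_poly (scaleN p) W) = poly p c * peval E s W"
  by (rule peval_map_poly) (simp_all add: evaluationD[OF E])

text \<open>The axioms for constants and \<partial> extend by induction to all of
  \<complex>[\<partial>]: in the second argument \<partial> becomes \<lambda> + \<partial>, in the
  first -\<lambda>.\<close>

lemma peval_act_scale_right:
  "peval E s (act x (scaleN p w)) = poly p (s + c) * peval E s (act x w)"
proof (induction p)
  case 0
  then show ?case by simp
next
  case (pCons a p)
  note add = additive.add[OF additive_peval[OF evaluationD(1)[OF E]]]
  show ?case
    by (simp add: scale_pConsN[of a p] add_right const_right del_right add
        peval_map_scale evaluationD[OF E] pCons.IH algebra_simps del: N.scale_scale)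
qed

lemma peval_act_scale_left:
  "peval E s (act (scaleR p x) w) = poly p (- s) * peval E s (act x w)"
proof (induction p)
  case 0
  then show ?case by simp
next
  case (pCons a p)
  note add = additive.add[OF additive_peval[OF evaluationD(1)[OF E]]]
  note minus = additive.minus[OF additive_peval[OF evaluationD(1)[OF E]]]
  show ?case
    by (simp add: scale_pConsR[of a p] add_left const_left del_left add minus
        peval_map_scale evaluationD[OF E] pCons.IH algebra_simps del: R.scale_scale)
qed

end

end

section \<open>Free modules of rank one and evaluation at \<partial> = \<open>z\<close>\<close>

locale rank_one =
  fixes scaleN :: "complex poly \<Rightarrow> 'n::ab_group_add \<Rightarrow> 'n" and v :: 'n
  assumes free: "free_rank_one scaleN v"

sublocale rank_one \<subseteq> rank: module scaleN
  using free by (simp add: free_rank_one_def)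

context rank_one
begin

definition coord :: "'n \<Rightarrow> complex poly" where
  "coord w = rank.representation {v} w v"

definition ev :: "complex \<Rightarrow> 'n \<Rightarrow> complex" where
  "ev z w = poly (coord w) z"

lemma independent: "rank.independent {v}" and span: "w \<in> rank.span {v}"
  using free by (auto simp: free_rank_one_def)

lemma coord_add: "coord (u + w) = coord u + coord w"
  by (simp add: coord_def rank.representation_add independent span)

lemma coord_scale: "coord (scaleN p w) = p * coord w"
  by (simp add: coord_def rank.representation_scale independent span)

lemma coord_generator: "coord v = 1"
  by (simp add: coord_def rank.representation_basis independent)

lemma scale_coord: "scaleN (coord w) v = w"
  using rank.sum_representation_eq[of "{v}" w "{v}"] by (simp add: coord_def independent span)

lemma evaluation_ev: "evaluation scaleN (ev z) z"
  unfolding evaluation_def by (auto intro!: additive.intro simp: ev_def coord_add coord_scale)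

lemmas additive_ev = evaluationD(1)[OF evaluation_ev]
  and ev_scale = evaluationD(2)[OF evaluation_ev]
  and ev_0 [simp] = evaluationD(3)[OF evaluation_ev]

lemma ev_generator [simp]: "ev z v = 1"
  by (simp add: ev_def coord_generator)

lemma ev_separating: "(\<And>z. ev z w = 0) \<Longrightarrow> w = 0"
  using poly_all_0_iff_0[of "coord w"] scale_coord[of w] by (simp add: ev_def)

lemma peval_ev_eqI:
  assumes "\<And>s z. peval (ev z) s V = peval (ev z) s W"
  shows "V = W"
proof -
  have "V - W = 0"
    by (rule peval_separating[of ev])
      (simp_all add: ev_separating assms additive.diff[OF additive_peval[OF additive_ev]])
  then show ?thesis by simp
qed

text \<open>Separation is used twice: the evaluations at \<partial> separate the module, hence those
  at (\<lambda>, \<partial>) separate the polynomials in \<lambda>.\<close>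

lemma peval_peval_ev_eqI:
  assumes "\<And>s t z. peval (peval (ev z) s) t P = peval (peval (ev z) s) t Q"
  shows "P = Q"
proof -
  have "P - Q = 0"
  proof (rule peval_separating[of "\<lambda>(s, z). peval (ev z) s"])
    show "W = 0" if "\<And>r. (case r of (s, z) \<Rightarrow> peval (ev z) s) W = 0" for W
      using that by (intro peval_ev_eqI) (simp add: split_paired_all)
  qed (auto simp: assms additive.diff[OF additive_peval[OF additive_peval[OF additive_ev]]])
  then show ?thesis by simp
qed

lemma peval_ev_act:
  assumes "lambda_map scaleA scaleN act"
  shows "peval (ev z) s (act x w) = ev (s + z) w * peval (ev z) s (act x v)"
proof -
  interpret lambda_map scaleA scaleN act by fact
  show ?thesis
    using peval_act_scale_right[OF evaluation_ev, of z s x "coord w" v]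
    by (simp add: scale_coord ev_def)
qed

abbreviation ev2 :: "complex \<Rightarrow> complex \<Rightarrow> complex \<Rightarrow> 'n poly poly \<Rightarrow> complex" where
  "ev2 s t z \<equiv> peval (peval (ev z) s) t"

lemma additive_ev2: "additive (ev2 s t z)"
  by (intro additive_peval additive_ev)

lemma ev2_mult_mu: "ev2 s t z (mult_mu q) = t * ev2 s t z q"
  by (simp add: mult_mu_def)

lemma ev2_mult_lambda: "ev2 s t z (mult_lambda q) = s * ev2 s t z q"
  unfolding mult_lambda_def by (rule peval_map_poly) simp_all

lemma ev2_const2: "ev2 s t z (const2 u) = ev z u"
  by (simp add: const2_def)

lemma const2_0: "const2 0 = 0"
  by (simp add: const2_def)

lemma subst_op_0: "subst_op T e 0 = 0" if "e 0 = 0"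
  using that by (simp add: subst_op_def)

lemma ev2_subst:
  assumes "\<And>q. ev2 s t z (T q) = \<tau> * ev2 s t z q"
  shows "ev2 s t z (subst_op T const2 W) = peval (ev z) \<tau> W"
  by (subst eval_subst_op[where E = "ev2 s t z" and \<tau> = \<tau>])
    (simp_all add: additive_ev2 assms ev2_const2 const2_0)

lemma ev2_subst_subst:
  assumes "\<And>q. ev2 s t z (T q) = \<tau> * ev2 s t z q" "\<And>q. ev2 s t z (S q) = \<sigma> * ev2 s t z q"
    and "f 0 = 0"
  shows "ev2 s t z (subst_op S (\<lambda>w. subst_op T const2 (f w)) W) =
    peval (\<lambda>w. peval (ev z) \<tau> (f w)) \<sigma> W"
  by (subst eval_subst_op[where E = "ev2 s t z" and \<tau> = \<sigma>])
    (simp_all add: additive_ev2 assms(2,3) ev2_subst[OF assms(1)] subst_op_0 const2_0)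

text \<open>
  Both sides at \<open>w\<close> evaluate to \<open>ev (s + t + z) w\<close> times their value at the generator, so the
  module axiom reduces to an identity between the symbols \<open>peval (ev z) s (act x v)\<close>.
\<close>

lemma act_bracket_iff:
  fixes B :: "'r::ab_group_add poly" and scaleA :: "complex poly \<Rightarrow> 'r \<Rightarrow> 'r"
  assumes "lambda_map scaleA scaleN act"
  defines "F \<equiv> \<lambda>x s z. peval (ev z) s (act x v)"
  shows "(\<forall>w. subst_op mult_mu (\<lambda>w. subst_op mult_lambda const2 (act x w)) (act y w) -
      subst_op mult_lambda (\<lambda>w. subst_op mult_mu const2 (act y w)) (act x w) =
      subst_op mult_lambda
        (\<lambda>r. subst_op (\<lambda>q. mult_lambda q + mult_mu q) const2 (act r w)) B) \<longleftrightarrow>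
    (\<forall>s t z. F y t (z + s) * F x s z - F x s (z + t) * F y t z =
      peval (\<lambda>r. F r (s + t) z) s B)"
    (is "(\<forall>w. ?l w - ?m w = ?r w) \<longleftrightarrow> ?rhs")
proof -
  interpret lambda_map scaleA scaleN act by fact
  have act: "peval (ev z) s (act x w) = F x s z * ev (s + z) w" for x s z w
    unfolding F_def by (subst peval_ev_act[OF assms(1)]) (rule mult.commute)
  have F0: "F 0 s z = 0" for s z by (simp add: F_def)
  have shift: "z + s = s + z" "s + (t + z) = s + t + z" "t + (s + z) = s + t + z"
    for s t z :: complex by simp_all
  have l: "ev2 s t z (?l w) = ev (s + t + z) w * (F y t (z + s) * F x s z)" for s t z w
    by (subst ev2_subst_subst[where \<tau> = s and \<sigma> = t])
      (simp_all add: ev2_mult_mu ev2_mult_lambda act peval_cmult shift(2,3) shift(1)[of z s]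
        add.commute[of t s])
  have m: "ev2 s t z (?m w) = ev (s + t + z) w * (F x s (z + t) * F y t z)" for s t z w
    by (subst ev2_subst_subst[where \<tau> = t and \<sigma> = s])
      (simp_all add: ev2_mult_mu ev2_mult_lambda act peval_cmult shift(2,3) shift(1)[of z t])
  have act_w: "(\<lambda>r. peval (ev z) (s + t) (act r w)) = (\<lambda>r. ev (s + t + z) w * F r (s + t) z)"
    for s t z w by (simp add: act mult.commute)
  have r: "ev2 s t z (?r w) = ev (s + t + z) w * peval (\<lambda>r. F r (s + t) z) s B" for s t z w
    by (subst ev2_subst_subst[where \<tau> = "s + t" and \<sigma> = s])
      (simp_all add: ev2_mult_mu ev2_mult_lambda act_w F0 additive.add[OF additive_ev2]
        peval_cmult distrib_right)
  show ?thesis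
  proof
    assume "\<forall>w. ?l w - ?m w = ?r w"
    \<comment> \<open>At the generator the common factor \<open>ev (s + t + z) v\<close> is
      1.\<close>
    then have "ev2 s t z (?l v) - ev2 s t z (?m v) = ev2 s t z (?r v)" for s t z
      by (simp add: additive.diff[OF additive_ev2, symmetric])
    then show ?rhs unfolding l m r by simp
  next
    assume *: ?rhs
    show "\<forall>w. ?l w - ?m w = ?r w"
    proof (intro allI peval_peval_ev_eqI)
      show "ev2 s t z (?l w - ?m w) = ev2 s t z (?r w)" for s t z w
        unfolding additive.diff[OF additive_ev2] l m r using *
        by (simp add: right_diff_distrib[symmetric])
    qed
  qed
qed

end

text \<open>Substitution of a polynomial in \<lambda> (outer) and \<partial> (inner) into
  \<open>p\<close>: \<open>lift [:0, -1:] p\<close> is \<open>p\<close> at -\<lambda>, and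
  \<open>lift [:del, 1:] p\<close> is \<open>p\<close> at \<partial> + \<lambda>.\<close>

definition lift :: "complex poly poly \<Rightarrow> complex poly \<Rightarrow> complex poly poly" where
  "lift q p = poly (map_poly (\<lambda>c. [:[:c:]:]) p) q"

lemma poly_lift: "poly (poly (lift q p) [:s:]) z = poly p (poly (poly q [:s:]) z)"
  unfolding lift_def by (induction p) (simp_all add: map_poly_pCons)

context rank_one
begin

lemma coord_0: "coord 0 = 0"
  using coord_scale[of 0 0] by simp

lemma poly_map_coord: "poly (poly (map_poly coord W) [:s:]) z = peval (ev z) s W"
  by (induction W) (simp_all add: map_poly_pCons coord_0 ev_def[symmetric])

lemma peval_ev_of_poly:
  "peval (ev z) s (map_poly (\<lambda>p. scaleN p v) P) = poly (poly P [:s:]) z"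
  by (induction P) (simp_all add: map_poly_pCons ev_scale)

lemma peval_ev_map_scale: "peval (ev z) s (map_poly (scaleN p) W) = poly p z * peval (ev z) s W"
  by (rule peval_map_poly) (simp_all add: ev_scale)

text \<open>This interchanges the two variables, making \<partial> the outer one so that degrees in
  \<partial> become available.\<close>

lemma peval_ev_section: "\<exists>Q. \<forall>s z. peval (ev z) s W = poly (section_poly Q s) z"
proof (induction W)
  case 0
  then show ?case by (intro exI[of _ 0]) (simp add: section_poly_def)
next
  case (pCons u W)
  then obtain Q where Q: "peval (ev z) s W = poly (section_poly Q s) z" for s z by blast
  have "section_poly (map_poly (\<lambda>c. [:c:]) (coord u) + smult [:0, 1:] Q) s =
      coord u + smult s (section_poly Q s)" for s
    by (rule poly_eqI) (simp add: coeff_map_poly)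
  then show ?case
    by (intro exI[of _ "map_poly (\<lambda>c. [:c:]) (coord u) + smult [:0, 1:] Q"])
      (simp add: Q ev_def[of _ u])
qed

text \<open>Sesquilinearity forces the formula: the coefficients of \<open>x\<close> enter at
  -\<lambda>, the coordinate of \<open>w\<close> at \<partial> + \<lambda>.\<close>

lemma lambda_map_extension:
  fixes scaleA :: "complex poly \<Rightarrow> 'r::ab_group_add \<Rightarrow> 'r" and V :: "'r \<Rightarrow> 'n poly"
  assumes "module scaleA" and fin: "finite B"
    and indep: "\<not> module.dependent scaleA B" and spanB: "module.span scaleA B = UNIV"
  shows "\<exists>!act. lambda_map scaleA scaleN act \<and> (\<forall>b\<in>B. act b v = V b)"
proof -
  interpret R: module scaleA by fact
  define rep where "rep = R.representation B"
  define act where "act x w = map_poly (\<lambda>p. scaleN p v)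
    ((\<Sum>b\<in>B. lift [:0, -1:] (rep x b) * map_poly coord (V b)) * lift [:del, 1:] (coord w))" for x w
  have rep: "rep (x + y) b = rep x b + rep y b" "rep (scaleA p x) b = p * rep x b" for x y p b
    using indep spanB by (simp_all add: rep_def R.representation_add R.representation_scale)
  have E: "peval (ev z) s (act x w) =
      (\<Sum>b\<in>B. poly (rep x b) (- s) * peval (ev z) s (V b)) * poly (coord w) (s + z)" for x w s z
    unfolding act_def peval_ev_of_poly
    by (simp add: poly_sum poly_lift poly_map_coord)
  note add = additive.add[OF additive_peval[OF additive_ev]]
  note minus = additive.minus[OF additive_peval[OF additive_ev]]
  have lm: "lambda_map scaleA scaleN act"
    by (unfold_locales; intro peval_ev_eqI)
      (simp_all add: E rep add minus peval_ev_map_scale coord_add coord_scale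
        algebra_simps sum.distrib sum_distrib_left sum_negf)
  have val: "act b v = V b" if "b \<in> B" for b
  proof (rule peval_ev_eqI)
    have "peval (ev z) s (act b v) = (\<Sum>a\<in>B. if a = b then peval (ev z) s (V a) else 0)" for s z
      unfolding E by (simp add: rep_def R.representation_basis[OF indep that] coord_generator
          if_distrib[of "\<lambda>p. poly p _"] cong: if_cong) (rule sum.cong; simp)
    then show "peval (ev z) s (act b v) = peval (ev z) s (V b)" for s z
      using fin that by simp
  qed
  show ?thesis
  proof (rule ex1I[of _ act])
    fix act' assume "lambda_map scaleA scaleN act' \<and> (\<forall>b\<in>B. act' b v = V b)"
    then have lm': "lambda_map scaleA scaleN act'" and val': "\<And>b. b \<in> B \<Longrightarrow> act' b v = V b" by auto
    note ev_left = additive.add[OF lambda_map.additive_peval_act(1)[OF _ evaluation_ev]]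
      lambda_map.peval_act_scale_left[OF _ evaluation_ev]
      additive.zero[OF lambda_map.additive_peval_act(1)[OF _ evaluation_ev]]
    \<comment> \<open>Agreement on \<open>B\<close> spreads to all \<open>x\<close> at the
      generator, and from the generator to all \<open>w\<close>.\<close>
    have "peval (ev z) s (act' x v) = peval (ev z) s (act x v)" for x s z
    proof -
      have "x \<in> R.span B" using spanB by simp
      then show ?thesis
        by (induction rule: R.span_induct_alt)
          (simp_all add: ev_left[OF lm] ev_left[OF lm'] val val')
    qed
    then have "act' x w = act x w" for x w
      by (intro peval_ev_eqI) (metis peval_ev_act lm lm')
    then show "act' = act" by blast
  qed (use lm val in blast)
qed

end

section \<open>The module axiom in terms of symbols\<close>

locale rank_one_act =
  alg: lie_conformal_algebra scaleA bracket + rank_one scaleN v +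
  action: lambda_map scaleA scaleN act
  for scaleA :: "complex poly \<Rightarrow> 'r::ab_group_add \<Rightarrow> 'r"
    and bracket :: "'r \<Rightarrow> 'r \<Rightarrow> 'r poly"
    and scaleN :: "complex poly \<Rightarrow> 'n::ab_group_add \<Rightarrow> 'n"
    and v :: 'n
    and act :: "'r \<Rightarrow> 'n \<Rightarrow> 'n poly"
begin

text \<open>\<open>symbol x s z\<close> is the value at \<open>\<lambda> = s\<close>, \<open>\<partial> = z\<close> of the polynomial \<open>X\<close> with \<open>x\<^sub>\<lambda> v = X(\<lambda>, \<partial>) v\<close>.\<close>

definition symbol :: "'r \<Rightarrow> complex \<Rightarrow> complex \<Rightarrow> complex" where
  "symbol x s z = peval (ev z) s (act x v)"

text \<open>The bracket's own variable is \<lambda> = \<open>s\<close>, whereas its coefficients act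
  on \<open>v\<close> with parameter \<lambda> + \<mu> = \<open>s + t\<close>.\<close>

definition bracket_symbol :: "'r \<Rightarrow> 'r \<Rightarrow> complex \<Rightarrow> complex \<Rightarrow> complex \<Rightarrow> complex" where
  "bracket_symbol x y s t z = peval (\<lambda>r. symbol r (s + t) z) s (bracket x y)"

definition compatible :: "'r \<Rightarrow> 'r \<Rightarrow> bool" where
  "compatible x y \<longleftrightarrow> (\<forall>s t z.
    symbol y t (z + s) * symbol x s z - symbol x s (z + t) * symbol y t z =
      bracket_symbol x y s t z)"

lemma conformal_module_iff:
  "conformal_module scaleA bracket scaleN act \<longleftrightarrow> (\<forall>x y. compatible x y)"
proof -
  have "conformal_module scaleA bracket scaleN act \<longleftrightarrow>
      conformal_module_axioms bracket act"
    by (simp add: conformal_module_def alg.lie_conformal_algebra_axioms action.lambda_map_axioms)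
  also have "\<dots> \<longleftrightarrow> (\<forall>x y. compatible x y)"
    unfolding conformal_module_axioms_def compatible_def bracket_symbol_def symbol_def
    using act_bracket_iff[OF action.lambda_map_axioms] by meson
  finally show ?thesis .
qed

lemma evaluation_symbol: "evaluation scaleA (\<lambda>r. symbol r s z) (- s)"
  unfolding evaluation_def symbol_def
  using action.additive_peval_act(1)[OF evaluation_ev] action.peval_act_scale_left[OF evaluation_ev]
  by blast

lemmas symbol_add = additive.add[OF evaluationD(1)[OF evaluation_symbol]]
  and symbol_scale = evaluationD(2)[OF evaluation_symbol]
  and symbol_0 [simp] = evaluationD(3)[OF evaluation_symbol]

lemma bracket_symbol_add:
  "bracket_symbol (x + y) w s t z = bracket_symbol x w s t z + bracket_symbol y w s t z"
  unfolding bracket_symbol_def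
  by (rule additive.add[OF alg.additive_peval_act(1)[OF evaluation_symbol]])

lemma bracket_symbol_scale:
  "bracket_symbol (scaleA p x) w s t z = poly p (- s) * bracket_symbol x w s t z"
  unfolding bracket_symbol_def by (rule alg.peval_act_scale_left[OF evaluation_symbol])

lemma bracket_symbol_0 [simp]: "bracket_symbol 0 w s t z = 0"
  by (simp add: bracket_symbol_def)

text \<open>On symbols at \<open>s + t\<close> the operator \<partial> acts as
  \<open>- (s + t)\<close>, so -\<lambda>-\<partial> evaluates to \<open>t\<close> and skew-symmetry
  exchanges \<open>s\<close> and \<open>t\<close>.\<close>

lemma bracket_symbol_swap: "bracket_symbol x y s t z = - bracket_symbol y x t s z"
proof -
  let ?E = "peval (\<lambda>r. symbol r (s + t) z) s"
  interpret E: additive ?E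
    by (intro additive_peval evaluationD(1)[OF evaluation_symbol])
  have "?E (subst_op (\<lambda>q. - pCons 0 q - map_poly (scaleA del) q) (\<lambda>r. [:r:]) (bracket y x)) =
      peval (\<lambda>r. ?E [:r:]) t (bracket y x)"
  proof (rule eval_subst_op)
    show "?E (- pCons 0 q - map_poly (scaleA del) q) = t * ?E q" for q
      by (simp add: E.diff E.minus alg.peval_map_scale[OF evaluation_symbol] algebra_simps)
  qed (simp_all add: E.additive_axioms)
  then show ?thesis
    unfolding bracket_symbol_def by (subst alg.skew) (simp add: E.minus add.commute)
qed

lemma compatible_sym: "compatible x y \<Longrightarrow> compatible y x"
  unfolding compatible_def by (subst bracket_symbol_swap) (simp add: algebra_simps)

text \<open>Both sides of the axiom are additive in \<open>x\<close>, and scaling \<open>x\<close>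
  by \<open>p\<close> multiplies both by \<open>poly p (- s)\<close>.\<close>

lemma compatible_span:
  assumes "x \<in> alg.R.span B" "\<And>b. b \<in> B \<Longrightarrow> compatible b y"
  shows "compatible x y"
  using assms(1)
proof (induction rule: alg.R.span_induct_alt)
  case base
  then show ?case by (simp add: compatible_def)
next
  case (step p b x)
  have "symbol y t (z + s) * symbol (scaleA p b + x) s z -
      symbol (scaleA p b + x) s (z + t) * symbol y t z =
    poly p (- s) * (symbol y t (z + s) * symbol b s z - symbol b s (z + t) * symbol y t z) +
      (symbol y t (z + s) * symbol x s z - symbol x s (z + t) * symbol y t z)" for s t z
    by (simp add: symbol_add symbol_scale algebra_simps)
  then show ?case
    using step assms(2)[of b] by (simp add: compatible_def bracket_symbol_add bracket_symbol_scale)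
qed

lemma conformal_moduleI:
  assumes "alg.R.span B = UNIV" "\<And>b c. b \<in> B \<Longrightarrow> c \<in> B \<Longrightarrow> compatible b c"
  shows "conformal_module scaleA bracket scaleN act"
  unfolding conformal_module_iff
  using compatible_span[of _ B] compatible_sym assms by (metis UNIV_I)

lemma act_eq_0_if_symbol_eq_0:
  assumes "alg.R.span B = UNIV" "\<And>b s z. b \<in> B \<Longrightarrow> symbol b s z = 0"
  shows "act x w = 0"
proof -
  have "symbol x s z = 0" for s z
  proof -
    have "x \<in> alg.R.span B" using assms by simp
    then show ?thesis
      by (induction rule: alg.R.span_induct_alt) (simp_all add: symbol_add symbol_scale assms)
  qed
  then show ?thesis
    by (intro peval_ev_eqI)
      (subst peval_ev_act[OF action.lambda_map_axioms], simp add: symbol_def)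
qed

end

subsection \<open>The algebras TSV(a,b) and TSV(c)\<close>

text \<open>A common form of both families, with \<open>h\<close> equal to 1 for TSV(a,b) and to
  -\<partial> - 2c for TSV(c).\<close>

locale tsv = free_LMY scaleA bracket L M Y
  for scaleA :: "complex poly \<Rightarrow> 'r::ab_group_add \<Rightarrow> 'r"
    and bracket :: "'r \<Rightarrow> 'r \<Rightarrow> 'r poly"
    and L M Y :: 'r
    and aY bY aM bM :: complex
    and h :: "complex poly" +
  assumes h: "h \<noteq> 0"
    and LL: "bracket L L = [: scaleA del L, scaleA [:2:] L :]"
    and LY: "bracket L Y = [: scaleA (del + [:bY:]) Y, scaleA [:aY:] Y :]"
    and LM: "bracket L M = [: scaleA (del + [:bM:]) M, scaleA [:aM:] M :]"
    and YY: "bracket Y Y = [: scaleA (del * h) M, scaleA ([:2:] * h) M :]"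
    and YM: "bracket Y M = 0"
    and MM: "bracket M M = 0"

lemma TSV_ab_imp_tsv:
  assumes "TSV_ab a b scaleA bracket L M Y"
  shows "tsv scaleA bracket L M Y a b (2 * (a - 1)) (2 * b) 1"
proof -
  interpret TSV_ab a b scaleA bracket L M Y by fact
  show ?thesis
    by unfold_locales (simp_all add: LL LY LM YY YM MM)
qed

lemma TSV_c_imp_tsv:
  assumes "TSV_c c scaleA bracket L M Y"
  shows "tsv scaleA bracket L M Y (3 / 2) c 0 (2 * c) (- del - [:2 * c:])"
proof -
  interpret TSV_c c scaleA bracket L M Y by fact
  show ?thesis
    by unfold_locales (simp_all add: LL LY LM YY YM MM)
qed

locale tsv_act =
  rank_one_act scaleA bracket scaleN v act +
  tsv: tsv scaleA bracket L M Y aY bY aM bM h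
  for scaleA :: "complex poly \<Rightarrow> 'r::ab_group_add \<Rightarrow> 'r"
    and bracket :: "'r \<Rightarrow> 'r \<Rightarrow> 'r poly"
    and scaleN :: "complex poly \<Rightarrow> 'n::ab_group_add \<Rightarrow> 'n"
    and v :: 'n
    and act :: "'r \<Rightarrow> 'n \<Rightarrow> 'n poly"
    and L M Y :: 'r
    and aY bY aM bM :: complex
    and h :: "complex poly"
begin

text \<open>Here \<partial> becomes \<open>- s - t\<close> and \<lambda> becomes \<open>s\<close>,
  so for instance \<partial> + 2\<lambda> becomes \<open>s - t\<close>.\<close>

lemma bracket_symbol_generators:
  "bracket_symbol L L s t z = (s - t) * symbol L (s + t) z"
  "bracket_symbol L Y s t z = ((aY - 1) * s - t + bY) * symbol Y (s + t) z"
  "bracket_symbol L M s t z = ((aM - 1) * s - t + bM) * symbol M (s + t) z"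
  "bracket_symbol Y Y s t z = (s - t) * poly h (- s - t) * symbol M (s + t) z"
  "bracket_symbol Y M s t z = 0"
  "bracket_symbol M M s t z = 0"
  unfolding bracket_symbol_def tsv.LL tsv.LY tsv.LM tsv.YY tsv.YM tsv.MM
  by (simp_all add: symbol_scale algebra_simps)

text \<open>Only the pair \<open>L\<close>, \<open>Y\<close> constrains \<open>\<gamma>\<close>: it
  requires \<open>((aY - 1) * s + bY) * \<gamma> = 0\<close>.\<close>

lemma conformal_module_tsvI:
  assumes "\<And>s z. symbol L s z = z + \<alpha> * s + \<beta>" "\<And>s z. symbol Y s z = \<gamma>"
    "\<And>s z. symbol M s z = 0" "\<gamma> \<noteq> 0 \<Longrightarrow> aY = 1 \<and> bY = 0"
  shows "conformal_module scaleA bracket scaleN act"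
proof (rule conformal_moduleI[OF tsv.span])
  have "compatible L L" "compatible L Y" "compatible L M" "compatible Y Y"
      "compatible Y M" "compatible M M"
    using assms(4) unfolding compatible_def bracket_symbol_generators assms(1-3)
    by (cases "\<gamma> = 0"; simp add: algebra_simps)+
  then show "compatible x y" if "x \<in> {L, M, Y}" "y \<in> {L, M, Y}" for x y
    using that compatible_sym by blast
qed

theorem symbols_if_nontrivial:
  assumes "conformal_module scaleA bracket scaleN act" "nontrivial_action act"
  shows "\<exists>\<alpha> \<beta> \<gamma>. (\<forall>s z. symbol L s z = z + \<alpha> * s + \<beta>) \<and> (\<forall>s z. symbol Y s z = \<gamma>) \<and>
    (\<forall>s z. symbol M s z = 0) \<and> (\<gamma> \<noteq> 0 \<longrightarrow> aY = 1 \<and> bY = 0)"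
proof -
  have comm: "symbol y t (z + s) * symbol x s z - symbol x s (z + t) * symbol y t z =
      bracket_symbol x y s t z" for x y s t z
    using assms(1) unfolding conformal_module_iff compatible_def by blast
  have "\<forall>x. \<exists>Q. \<forall>s z. symbol x s z = poly (section_poly Q s) z"
    using peval_ev_section unfolding symbol_def by blast
  from choice[OF this] obtain Q where Q: "symbol x s z = poly (section_poly (Q x) s) z" for x s z
    by blast
  have const: "\<exists>g. \<forall>s z. symbol x s z = poly g s"
    if self_comm: "\<And>s t z. symbol x t (z + s) * symbol x s z - symbol x s (z + t) * symbol x t z = 0" for x
  proof -
    obtain g where "Q x = [:g:]"
      using degree_0_if_commuting[of "symbol x" "Q x", OF Q self_comm] by (rule degree_eq_zeroE)
    then show ?thesis
      by (auto simp: Q section_poly_def map_poly_pCons)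
  qed
  \<comment> \<open>If \<open>L\<close> acts by zero, then \<open>[L\<^sub>\<lambda> x]\<^bsub>\<lambda>+\<mu>\<^esub> v = 0\<close> for \<open>x = Y, M\<close>, whose coefficient at \<open>\<lambda> = 0\<close> is nonzero.\<close>
  have "\<not> (\<forall>s z. symbol L s z = 0)"
  proof
    assume L0: "\<forall>s z. symbol L s z = 0"
    have zero: "symbol x s z = 0"
      if "\<And>t. (b - t) * symbol x t z = 0" for x b s z
    proof -
      \<comment> \<open>The symbol is polynomial in \<lambda>, so a nonzero linear factor can be
        cancelled.\<close>
      have "[:b, -1:] * map_poly (ev z) (act x v) = 0"
        using that by (intro poly_ext) (simp add: symbol_def peval_def algebra_simps)
      then have "map_poly (ev z) (act x v) = 0"
        by (simp only: mult_eq_0_iff pCons_eq_0_iff) auto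
      then show ?thesis by (simp add: symbol_def peval_def)
    qed
    have "(bY - t) * symbol Y t z = 0" "(bM - t) * symbol M t z = 0" for t z
      using comm[of Y t z 0 L] comm[of M t z 0 L] L0
      by (simp_all add: bracket_symbol_generators)
    then have "symbol b s z = 0" if "b \<in> {L, M, Y}" for b s z
      using that L0 zero by blast
    then have "act x w = 0" for x w
      by (rule act_eq_0_if_symbol_eq_0[OF tsv.span])
    with assms(2) show False by (simp add: nontrivial_action_def)
  qed
  then obtain \<alpha> \<beta> where L: "symbol L s z = z + \<alpha> * s + \<beta>" for s z
    using virasoro_rank_one[of "symbol L" "Q L", OF Q] comm[of L _ _ _ L]
    unfolding bracket_symbol_generators by blast
  obtain m where m: "symbol M s z = poly m s" for s z
    using const[of M] comm[of M _ _ _ M] unfolding bracket_symbol_generators by blast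
  have "- t * poly m t = ((aM - 1) * s - t + bM) * poly m (s + t)" for s t
    using comm[of M t 0 s L] by (simp add: bracket_symbol_generators m L algebra_simps)
  then consider "m = 0" | d where "m = [:d:]"
    using primary_current_constant by blast
  then obtain d where d: "symbol M s z = d" for s z
    using m by cases auto
  have "d = 0"
  proof (rule ccontr)
    assume "d \<noteq> 0"
    \<comment> \<open>Commuting with a nonzero constant symbol removes the dependence on
      \<partial>.\<close>
    have "symbol Y s (0 + t) = symbol Y s 0" for s t
      using comm[of M t 0 s Y] \<open>d \<noteq> 0\<close> by (simp add: bracket_symbol_generators d)
    then have "symbol Y s z = symbol Y s 0" for s z by (metis add_0)
    then have "(s - t) * poly h (- s - t) = 0" for s t
      using comm[of Y t 0 s Y] \<open>d \<noteq> 0\<close> unfolding bracket_symbol_generators d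
      by (metis (no_types, lifting) diff_self mult.commute mult_eq_0_iff)
    \<comment> \<open>These points have difference 2 and sum \<open>- u\<close>, so every value of
      \<open>h\<close> is reached.\<close>
    from this[of "1 - u / 2" "- 1 - u / 2" for u] have "poly h u = 0" for u by simp
    then show False using tsv.h poly_all_0_iff_0 by blast
  qed
  then have M: "symbol M s z = 0" for s z by (simp add: d)
  obtain f where f: "symbol Y s z = poly f s" for s z
    using const[of Y] comm[of Y _ _ _ Y] unfolding bracket_symbol_generators M by auto
  have "- t * poly f t = ((aY - 1) * s - t + bY) * poly f (s + t)" for s t
    using comm[of Y t 0 s L] by (simp add: bracket_symbol_generators f L algebra_simps)
  from primary_current_constant[OF this]
  obtain \<gamma> where "\<forall>s z. symbol Y s z = \<gamma>" "\<gamma> \<noteq> 0 \<longrightarrow> aY = 1 \<and> bY = 0"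
    using f by auto
  with L M show ?thesis by blast
qed

end

section \<open>Classification and existence of the modules\<close>

context rank_one
begin

lemma tsv_actI:
  assumes "tsv scaleA bracket L M Y aY bY aM bM h" "lambda_map scaleA scaleN act"
  shows "tsv_act scaleA bracket scaleN v act L M Y aY bY aM bM h"
  using assms rank_one_axioms
  by (simp add: tsv_act_def rank_one_act_def tsv_def free_LMY_def)

lemma act_generator_iff:
  "act x v = W \<longleftrightarrow> (\<forall>s z. peval (ev z) s (act x v) = peval (ev z) s W)"
  using peval_ev_eqI by auto

lemma peval_ev_linear:
  "peval (ev z) s [: scaleN (del + [:\<beta>:]) v, scaleN [:\<alpha>:] v :] = z + \<alpha> * s + \<beta>"
  by (simp add: ev_scale algebra_simps)

lemma peval_ev_const: "peval (ev z) s [: scaleN [:\<gamma>:] v :] = \<gamma>"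
  by (simp add: ev_scale)

theorem tsv_module_classification:
  assumes "tsv scaleA bracket L M Y aY bY aM bM h"
    and "conformal_module scaleA bracket scaleN act" "nontrivial_action act"
  shows "\<exists>\<alpha> \<beta> \<gamma>. act L v = [: scaleN (del + [:\<beta>:]) v, scaleN [:\<alpha>:] v :] \<and>
    act Y v = [: scaleN [:\<gamma>:] v :] \<and> act M v = 0 \<and> (\<gamma> \<noteq> 0 \<longrightarrow> aY = 1 \<and> bY = 0)"
proof -
  interpret tsv_act scaleA bracket scaleN v act L M Y aY bY aM bM h
    using assms(2) by (intro tsv_actI assms(1)) (simp add: conformal_module_def)
  show ?thesis
    unfolding act_generator_iff peval_ev_linear peval_ev_const peval_0
    using symbols_if_nontrivial[OF assms(2,3)] unfolding symbol_def by blast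
qed

theorem tsv_module_ex1:
  assumes tsv: "tsv scaleA bracket L M Y aY bY aM bM h"
    and \<gamma>: "\<gamma> \<noteq> 0 \<Longrightarrow> aY = 1 \<and> bY = 0"
  shows "\<exists>!act. conformal_module scaleA bracket scaleN act \<and> nontrivial_action act \<and>
    act L v = [: scaleN (del + [:\<beta>:]) v, scaleN [:\<alpha>:] v :] \<and>
    act Y v = [: scaleN [:\<gamma>:] v :] \<and> act M v = 0"
proof -
  interpret tsv: tsv scaleA bracket L M Y aY bY aM bM h by fact
  define V where "V b = (if b = L then [: scaleN (del + [:\<beta>:]) v, scaleN [:\<alpha>:] v :]
    else if b = Y then [: scaleN [:\<gamma>:] v :] else 0)" for b
  have "V L = [: scaleN (del + [:\<beta>:]) v, scaleN [:\<alpha>:] v :]" "V Y = [: scaleN [:\<gamma>:] v :]" "V M = 0"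
    using tsv.distinct by (auto simp: V_def)
  then have ex1: "\<exists>!act. lambda_map scaleA scaleN act \<and>
      act L v = [: scaleN (del + [:\<beta>:]) v, scaleN [:\<alpha>:] v :] \<and>
      act Y v = [: scaleN [:\<gamma>:] v :] \<and> act M v = 0"
    using lambda_map_extension[of scaleA "{L, M, Y}" V]
      tsv.R.module_axioms tsv.independent tsv.span by (simp add: conj_ac)
  have "conformal_module scaleA bracket scaleN act \<and> nontrivial_action act"
    if act: "lambda_map scaleA scaleN act"
      "act L v = [: scaleN (del + [:\<beta>:]) v, scaleN [:\<alpha>:] v :]"
      "act Y v = [: scaleN [:\<gamma>:] v :]" "act M v = 0" for act
  proof
    interpret tsv_act scaleA bracket scaleN v act L M Y aY bY aM bM h
      by (rule tsv_actI[OF tsv act(1)])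
    have symbols: "symbol L s z = z + \<alpha> * s + \<beta>" "symbol Y s z = \<gamma>" "symbol M s z = 0" for s z
      unfolding symbol_def act(2-4) peval_ev_linear peval_ev_const by simp_all
    show "conformal_module scaleA bracket scaleN act"
      using symbols \<gamma> by (rule conformal_module_tsvI)
    have "act L v \<noteq> 0"
      using symbols(1)[of 0 "1 - \<beta>"] by (auto simp: symbol_def)
    then show "nontrivial_action act"
      unfolding nontrivial_action_def by blast
  qed
  moreover have "lambda_map scaleA scaleN act"
    if "conformal_module scaleA bracket scaleN act" for act
    using that by (simp add: conformal_module_def)
  \<comment> \<open>Given the values on the generators, sesquilinearity already implies the module
    axiom and non-triviality, so uniqueness is inherited from the extension lemma.\<close>
  ultimately have "conformal_module scaleA bracket scaleN act \<and> nontrivial_action act \<and>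
      act L v = [: scaleN (del + [:\<beta>:]) v, scaleN [:\<alpha>:] v :] \<and>
      act Y v = [: scaleN [:\<gamma>:] v :] \<and> act M v = 0 \<longleftrightarrow>
    lambda_map scaleA scaleN act \<and>
      act L v = [: scaleN (del + [:\<beta>:]) v, scaleN [:\<alpha>:] v :] \<and>
      act Y v = [: scaleN [:\<gamma>:] v :] \<and> act M v = 0" for act
    by blast
  with ex1 show ?thesis by presburger
qed

end

theorem theorem5p4:
  fixes a b c :: complex
    and scaleR :: "complex poly \<Rightarrow> 'r::ab_group_add \<Rightarrow> 'r"
    and bracket :: "'r \<Rightarrow> 'r \<Rightarrow> 'r poly"
    and L M Y :: 'r
    and scaleN :: "complex poly \<Rightarrow> 'n::ab_group_add \<Rightarrow> 'n"
    and v :: 'n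
  assumes "free_rank_one scaleN v"
  shows
    "(a \<noteq> 1 \<or> b \<noteq> 0 \<longrightarrow> TSV_ab a b scaleR bracket L M Y \<longrightarrow>
        (\<forall>act. conformal_module scaleR bracket scaleN act \<and> nontrivial_action act \<longrightarrow>
          (\<exists>\<alpha> \<beta>. act L v = [: scaleN (del + [:\<beta>:]) v, scaleN [:\<alpha>:] v :] \<and>
                 act Y v = 0 \<and> act M v = 0)) \<and>
        (\<forall>\<alpha> \<beta>. \<exists>!act. conformal_module scaleR bracket scaleN act \<and> nontrivial_action act \<and>
            act L v = [: scaleN (del + [:\<beta>:]) v, scaleN [:\<alpha>:] v :] \<and>
            act Y v = 0 \<and> act M v = 0)) \<and>
     (TSV_ab 1 0 scaleR bracket L M Y \<longrightarrow>
        (\<forall>act. conformal_module scaleR bracket scaleN act \<and> nontrivial_action act \<longrightarrow>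
          (\<exists>\<alpha> \<beta> \<gamma>. act L v = [: scaleN (del + [:\<beta>:]) v, scaleN [:\<alpha>:] v :] \<and>
                 act Y v = [: scaleN [:\<gamma>:] v :] \<and> act M v = 0)) \<and>
        (\<forall>\<alpha> \<beta> \<gamma>. \<exists>!act. conformal_module scaleR bracket scaleN act \<and> nontrivial_action act \<and>
            act L v = [: scaleN (del + [:\<beta>:]) v, scaleN [:\<alpha>:] v :] \<and>
            act Y v = [: scaleN [:\<gamma>:] v :] \<and> act M v = 0)) \<and>
     (TSV_c c scaleR bracket L M Y \<longrightarrow>
        (\<forall>act. conformal_module scaleR bracket scaleN act \<and> nontrivial_action act \<longrightarrow>
          (\<exists>\<alpha> \<beta>. act L v = [: scaleN (del + [:\<beta>:]) v, scaleN [:\<alpha>:] v :] \<and>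
                 act Y v = 0 \<and> act M v = 0)) \<and>
        (\<forall>\<alpha> \<beta>. \<exists>!act. conformal_module scaleR bracket scaleN act \<and> nontrivial_action act \<and>
            act L v = [: scaleN (del + [:\<beta>:]) v, scaleN [:\<alpha>:] v :] \<and>
            act Y v = 0 \<and> act M v = 0))"
proof -
  interpret rank_one scaleN v
    using assms by unfold_locales
  note zero = pCons_0_0 rank.scale_zero_left
  have classification: "\<exists>\<alpha> \<beta>. act L v = [: scaleN (del + [:\<beta>:]) v, scaleN [:\<alpha>:] v :] \<and>
      act Y v = 0 \<and> act M v = 0"
    if "tsv scaleR bracket L M Y aY bY aM bM h" "aY \<noteq> 1 \<or> bY \<noteq> 0"
      "conformal_module scaleR bracket scaleN act \<and> nontrivial_action act" for aY bY aM bM h act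
    using tsv_module_classification[OF that(1), of act] that(2,3) zero by metis
  have ex1: "\<exists>!act. conformal_module scaleR bracket scaleN act \<and> nontrivial_action act \<and>
      act L v = [: scaleN (del + [:\<beta>:]) v, scaleN [:\<alpha>:] v :] \<and> act Y v = 0 \<and> act M v = 0"
    if "tsv scaleR bracket L M Y aY bY aM bM h" for aY bY aM bM h \<alpha> \<beta>
    using tsv_module_ex1[OF that, of 0 \<beta> \<alpha>] by (simp add: zero)
  show ?thesis
  proof (intro conjI impI allI)
    assume "a \<noteq> 1 \<or> b \<noteq> 0" and tsv: "TSV_ab a b scaleR bracket L M Y"
    note tsv = TSV_ab_imp_tsv[OF tsv]
    show "\<exists>\<alpha> \<beta>. act L v = [: scaleN (del + [:\<beta>:]) v, scaleN [:\<alpha>:] v :] \<and> act Y v = 0 \<and> act M v = 0"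
      if "conformal_module scaleR bracket scaleN act \<and> nontrivial_action act" for act
      by (rule classification[OF tsv]) fact+
    show "\<exists>!act. conformal_module scaleR bracket scaleN act \<and> nontrivial_action act \<and>
        act L v = [: scaleN (del + [:\<beta>:]) v, scaleN [:\<alpha>:] v :] \<and> act Y v = 0 \<and> act M v = 0" for \<alpha> \<beta>
      by (rule ex1[OF tsv])
  next
    assume tsv: "TSV_ab 1 0 scaleR bracket L M Y"
    note tsv = TSV_ab_imp_tsv[OF tsv]
    show "\<exists>\<alpha> \<beta> \<gamma>. act L v = [: scaleN (del + [:\<beta>:]) v, scaleN [:\<alpha>:] v :] \<and>
        act Y v = [: scaleN [:\<gamma>:] v :] \<and> act M v = 0"
      if "conformal_module scaleR bracket scaleN act \<and> nontrivial_action act" for act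
      using tsv_module_classification[OF tsv, of act] that by blast
    show "\<exists>!act. conformal_module scaleR bracket scaleN act \<and> nontrivial_action act \<and>
        act L v = [: scaleN (del + [:\<beta>:]) v, scaleN [:\<alpha>:] v :] \<and>
        act Y v = [: scaleN [:\<gamma>:] v :] \<and> act M v = 0" for \<alpha> \<beta> \<gamma>
      by (rule tsv_module_ex1[OF tsv]) simp
  next
    assume tsv: "TSV_c c scaleR bracket L M Y"
    note tsv = TSV_c_imp_tsv[OF tsv]
    show "\<exists>\<alpha> \<beta>. act L v = [: scaleN (del + [:\<beta>:]) v, scaleN [:\<alpha>:] v :] \<and> act Y v = 0 \<and> act M v = 0"
      if "conformal_module scaleR bracket scaleN act \<and> nontrivial_action act" for act
      \<comment> \<open>The coefficient of \<lambda> is 3/2, which differs from 1.\<close>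
      by (rule classification[OF tsv _ that]) simp
    show "\<exists>!act. conformal_module scaleR bracket scaleN act \<and> nontrivial_action act \<and>
        act L v = [: scaleN (del + [:\<beta>:]) v, scaleN [:\<alpha>:] v :] \<and> act Y v = 0 \<and> act M v = 0" for \<alpha> \<beta>
      by (rule ex1[OF tsv])
  qed
qed

end
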